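(* For $\mathcal{L}\in\{\mathsf{IEL}^-,\mathsf{IEL}\}$ and every formula $A$: if $\mathcal{L}\Vdash A$ (i.e. $A$ is true in every $\mathcal{L}$-model) then $\mathcal{L}\vdash A$.
   Context: Formulas are built from a countably infinite set of propositional letters and $\bot$ using $\land,\lor,\rightarrow$ and a unary operator $\mathbf{K}$; $\neg A$ abbreviates $A\rightarrow\bot$. The system $\mathsf{IEL}^-$ has as axioms all instances, in this language, of: the axioms of intuitionistic propositional logic; distribution $\mathbf{K}(A\rightarrow B)\rightarrow(\mathbf{K}A\rightarrow\mathbf{K}B)$; co-reflection $A\rightarrow\mathbf{K}A$. The only rule is Modus Ponens. $\mathsf{IEL}$ is $\mathsf{IEL}^-$ plus all instances of intuitionistic reflection $\mathbf{K}A\rightarrow\neg\neg A$. $\mathcal{L}\vdash A$ means $A$ is derivable in $\mathcal{L}$. An $\mathsf{IEL}^-$-model is a quadruple $\langle W,R,\Vdash,E\rangle$ where $\langle W,R\rangle$ is a non-empty partial order; $\Vdash$ is a monotonic evaluation of propositional letters (if $u\Vdash p$ and $uRv$ then $v\Vdash p$); $E$ is a binary relation on $W$ such that, writing $R(u)=\{v: uRv\}$ and $E(u)=\{v: uEv\}$, $E(u)\subseteq R(u)$ for all $u$, and $uRv$ implies $E(v)\subseteq E(u)$. Forcing is extended to all formulas by the usual intuitionistic Kripke clauses ($u\nVdash\bot$; $u\Vdash A\land B$ iff $u\Vdash A$ and $u\Vdash B$; $u\Vdash A\lor B$ iff $u\Vdash A$ or $u\Vdash B$; $u\Vdash A\rightarrow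 B$ iff for all $v\in R(u)$, $v\Vdash A$ implies $v\Vdash B$) and $u\Vdash\mathbf{K}A$ iff $v\Vdash A$ for all $v\in E(u)$. An $\mathsf{IEL}$-model is an $\mathsf{IEL}^-$-model in which $E(u)\neq\emptyset$ for every $u\in W$. A formula is true in a model if it is forced at every world of it. *)

theory Defs
  imports Main
begin

datatype fm =
    Letter nat
  | Falsum  ("\<^bold>\<bottom>")
  | Conj fm fm  (infixr "\<^bold>\<and>" 65)
  | Disj fm fm  (infixr "\<^bold>\<or>" 60)
  | Impl fm fm  (infixr "\<^bold>\<rightarrow>" 55)
  | Know fm  ("\<^bold>K _" [80] 80)

abbreviation Neg :: "fm \<Rightarrow> fm"  ("\<^bold>\<not> _" [80] 80) where
  "\<^bold>\<not> A \<equiv> A \<^bold>\<rightarrow> \<^bold>\<bottom>"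

datatype logic = IEL_minus | IEL

inductive derivable :: "logic \<Rightarrow> fm \<Rightarrow> bool"  (infix "\<turnstile>" 50) for L :: logic where
  Weak: "L \<turnstile> A \<^bold>\<rightarrow> (B \<^bold>\<rightarrow> A)"
| Dist: "L \<turnstile> (A \<^bold>\<rightarrow> (B \<^bold>\<rightarrow> C)) \<^bold>\<rightarrow> ((A \<^bold>\<rightarrow> B) \<^bold>\<rightarrow> (A \<^bold>\<rightarrow> C))"
| ConjE1: "L \<turnstile> (A \<^bold>\<and> B) \<^bold>\<rightarrow> A"
| ConjE2: "L \<turnstile> (A \<^bold>\<and> B) \<^bold>\<rightarrow> B"
| ConjI: "L \<turnstile> A \<^bold>\<rightarrow> (B \<^bold>\<rightarrow> (A \<^bold>\<and> B))"
| DisjI1: "L \<turnstile> A \<^bold>\<rightarrow> (A \<^bold>\<or> B)"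
| DisjI2: "L \<turnstile> B \<^bold>\<rightarrow> (A \<^bold>\<or> B)"
| DisjE: "L \<turnstile> (A \<^bold>\<rightarrow> C) \<^bold>\<rightarrow> ((B \<^bold>\<rightarrow> C) \<^bold>\<rightarrow> ((A \<^bold>\<or> B) \<^bold>\<rightarrow> C))"
| ExFalso: "L \<turnstile> \<^bold>\<bottom> \<^bold>\<rightarrow> A"
| KDist: "L \<turnstile> \<^bold>K (A \<^bold>\<rightarrow> B) \<^bold>\<rightarrow> (\<^bold>K A \<^bold>\<rightarrow> \<^bold>K B)"
| CoReflection: "L \<turnstile> A \<^bold>\<rightarrow> \<^bold>K A"
| Reflection: "L = IEL \<Longrightarrow> L \<turnstile> \<^bold>K A \<^bold>\<rightarrow> \<^bold>\<not> \<^bold>\<not> A"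
| MP: "L \<turnstile> A \<^bold>\<rightarrow> B \<Longrightarrow> L \<turnstile> A \<Longrightarrow> L \<turnstile> B"

record 'w model =
  worlds :: "'w set"
  R :: "'w rel"
  val :: "'w \<Rightarrow> nat \<Rightarrow> bool"
  E :: "'w rel"

text \<open>For a relation \<open>S\<close>, the set of successors \<open>S(u)\<close> is the image \<open>S `` {u}\<close>.\<close>

definition is_IEL_minus_model :: "'w model \<Rightarrow> bool" where
  "is_IEL_minus_model M \<longleftrightarrow>
     worlds M \<noteq> {} \<and>
     partial_order_on (worlds M) (R M) \<and>
     (\<forall>u v p. (u, v) \<in> R M \<longrightarrow> val M u p \<longrightarrow> val M v p) \<and>
     E M \<subseteq> worlds M \<times> worlds M \<and>
     (\<forall>u\<in>worlds M. E M `` {u} \<subseteq> R M `` {u}) \<and>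
     (\<forall>u v. (u, v) \<in> R M \<longrightarrow> E M `` {v} \<subseteq> E M `` {u})"

definition is_IEL_model :: "'w model \<Rightarrow> bool" where
  "is_IEL_model M \<longleftrightarrow>
     is_IEL_minus_model M \<and> (\<forall>u\<in>worlds M. E M `` {u} \<noteq> {})"

fun is_model :: "logic \<Rightarrow> 'w model \<Rightarrow> bool" where
  "is_model IEL_minus M \<longleftrightarrow> is_IEL_minus_model M"
| "is_model IEL M \<longleftrightarrow> is_IEL_model M"

primrec forces :: "'w model \<Rightarrow> 'w \<Rightarrow> fm \<Rightarrow> bool" where
  "forces M u (Letter p) \<longleftrightarrow> val M u p"
| "forces M u \<^bold>\<bottom> \<longleftrightarrow> False"
| "forces M u (A \<^bold>\<and> B) \<longleftrightarrow> forces M u A \<and> forces M u B"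
| "forces M u (A \<^bold>\<or> B) \<longleftrightarrow> forces M u A \<or> forces M u B"
| "forces M u (A \<^bold>\<rightarrow> B) \<longleftrightarrow> (\<forall>v\<in>R M `` {u}. forces M v A \<longrightarrow> forces M v B)"
| "forces M u (\<^bold>K A) \<longleftrightarrow> (\<forall>v\<in>E M `` {u}. forces M v A)"

definition true_in :: "'w model \<Rightarrow> fm \<Rightarrow> bool" where
  "true_in M A \<longleftrightarrow> (\<forall>u\<in>worlds M. forces M u A)"

text \<open>HOL cannot quantify over all types inside a formula, so validity is relative to the type
  \<open>'w\<close> from which worlds are drawn; the set of worlds is an arbitrary non-empty subset of
  that type. For completeness \<open>'w\<close> must not be too small: over a finite type, for
  instance, there are formulas that are valid but not derivable. Any infinite type will do.\<close>

definition valid :: "'w itself \<Rightarrow> logic \<Rightarrow> fm \<Rightarrow> bool" where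
  "valid _ L A \<longleftrightarrow> (\<forall>M :: 'w model. is_model L M \<longrightarrow> true_in M A)"

end

(* The type of worlds is an arbitrary infinite type, possibly a countable one, so an underivable
   formula A is refuted in a finite model, which embeds into any infinite type. The worlds are the
   consistent prime theories relativised to the subformulas of A, ordered by inclusion; E relates
   X to Y if Y contains X together with every B such that K B is in X. If these formulas
   derive B, then X derives K B by distribution and co-reflection; this gives the truth lemma
   for K and, with reflection and B = falsum, the seriality of E. *)

theory Submission
  imports Defs
begin

section \<open>Derivability from hypotheses\<close>

inductive derivable_from :: "logic \<Rightarrow> fm set \<Rightarrow> fm \<Rightarrow> bool" for L X where
  Thm: "L \<turnstile> B \<Longrightarrow> derivable_from L X B"
| Hyp: "B \<in> X \<Longrightarrow> derivable_from L X B"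
| MP: "derivable_from L X (B \<^bold>\<rightarrow> C) \<Longrightarrow> derivable_from L X B \<Longrightarrow> derivable_from L X C"

lemma derivable_from_empty:
  assumes "derivable_from L {} B"
  shows "L \<turnstile> B"
  using assms by induction (auto intro: derivable.MP)

lemma derivable_from_weaken:
  assumes "derivable_from L X B"
  shows "derivable_from L X (C \<^bold>\<rightarrow> B)"
  using assms by (meson Weak derivable_from.MP Thm)

lemma derivable_imp_refl: "L \<turnstile> B \<^bold>\<rightarrow> B"
  by (meson Weak Dist derivable.MP)

text \<open>Modus Ponens is the only rule, so the usual induction with \<open>Weak\<close> and
  \<open>Dist\<close> goes through. As co-reflection is an axiom rather than a rule, hypotheses may
  be used freely together with K.\<close>

lemma deduction:
  assumes "derivable_from L (insert B X) C"
  shows "derivable_from L X (B \<^bold>\<rightarrow> C)"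
  using assms
proof induction
  case (Hyp C)
  then show ?case
    by (auto intro: derivable_from_weaken derivable_from.intros derivable_imp_refl)
next
  case (MP C D)
  then show ?case
    by (meson Dist derivable_from.MP Thm)
qed (simp add: derivable_from_weaken Thm)

lemma derivable_from_cut:
  assumes "derivable_from L (insert B X) C" and "derivable_from L X B"
  shows "derivable_from L X C"
  using assms deduction derivable_from.MP by blast

lemma derivable_from_Conj_iff:
  "derivable_from L X (B \<^bold>\<and> C) \<longleftrightarrow> derivable_from L X B \<and> derivable_from L X C"
  by (meson ConjE1 ConjE2 ConjI derivable_from.MP Thm)

lemma derivable_from_Disj_elim:
  assumes "derivable_from L X (B \<^bold>\<or> C)"
    and "derivable_from L (insert B X) D" and "derivable_from L (insert C X) D"
  shows "derivable_from L X D"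
  using assms deduction by (meson DisjE derivable_from.MP Thm)

lemma derivable_from_Falsum:
  assumes "derivable_from L X \<^bold>\<bottom>"
  shows "derivable_from L X B"
  using assms by (meson ExFalso derivable_from.MP Thm)

text \<open>K can be put in front of every formula of a derivation: co-reflection does this for
  theorems and for members of \<open>X\<close>, distribution carries it through Modus Ponens, and
  for the added hypotheses the result already lies in \<open>X\<close>.\<close>

lemma derivable_from_Know:
  assumes "derivable_from L (X \<union> {B. \<^bold>K B \<in> X}) C"
  shows "derivable_from L X (\<^bold>K C)"
  using assms
proof induction
  case (Thm C)
  then show ?case
    by (meson CoReflection derivable.MP derivable_from.Thm)
next
  case (Hyp C)
  then show ?case
    by (auto intro: derivable_from.intros CoReflection)
next
  case (MP C D)
  then show ?case
    by (meson KDist derivable_from.MP Thm)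
qed

section \<open>Subformulas\<close>

primrec subfms :: "fm \<Rightarrow> fm set" where
  "subfms (Letter p) = {Letter p}"
| "subfms \<^bold>\<bottom> = {\<^bold>\<bottom>}"
| "subfms (A \<^bold>\<and> B) = insert (A \<^bold>\<and> B) (subfms A \<union> subfms B)"
| "subfms (A \<^bold>\<or> B) = insert (A \<^bold>\<or> B) (subfms A \<union> subfms B)"
| "subfms (A \<^bold>\<rightarrow> B) = insert (A \<^bold>\<rightarrow> B) (subfms A \<union> subfms B)"
| "subfms (\<^bold>K A) = insert (\<^bold>K A) (subfms A)"

lemma finite_subfms: "finite (subfms A)"
  by (induction A) auto

lemma subfms_refl: "A \<in> subfms A"
  by (cases A) auto

lemma subfms_trans: "B \<in> subfms A \<Longrightarrow> subfms B \<subseteq> subfms A"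
  by (induction A) auto

lemma subfms_components:
  "B \<^bold>\<and> C \<in> subfms A \<Longrightarrow> B \<in> subfms A \<and> C \<in> subfms A"
  "B \<^bold>\<or> C \<in> subfms A \<Longrightarrow> B \<in> subfms A \<and> C \<in> subfms A"
  "B \<^bold>\<rightarrow> C \<in> subfms A \<Longrightarrow> B \<in> subfms A \<and> C \<in> subfms A"
  "\<^bold>K B \<in> subfms A \<Longrightarrow> B \<in> subfms A"
  using subfms_trans subfms_refl by fastforce+

section \<open>Prime theories within the subformulas\<close>

text \<open>Restricting membership and closure to subformulas keeps the collection finite.
  Consistency is stated by derivability because falsum may fail to be a subformula of
  \<open>A\<close>.\<close>

definition prime_theories :: "logic \<Rightarrow> fm \<Rightarrow> fm set set" where
  "prime_theories L A = {X. X \<subseteq> subfms A \<and> \<not> derivable_from L X \<^bold>\<bottom> \<and>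
     (\<forall>B\<in>subfms A. derivable_from L X B \<longrightarrow> B \<in> X) \<and>
     (\<forall>B C. B \<^bold>\<or> C \<in> X \<longrightarrow> B \<in> X \<or> C \<in> X)}"

lemma finite_prime_theories: "finite (prime_theories L A)"
  by (rule finite_subset[of _ "Pow (subfms A)"]) (auto simp: prime_theories_def finite_subfms)

lemma prime_theory_mem_iff:
  assumes "X \<in> prime_theories L A" and "B \<in> subfms A"
  shows "B \<in> X \<longleftrightarrow> derivable_from L X B"
  using assms by (auto simp: prime_theories_def intro: Hyp)

text \<open>A Lindenbaum argument: among the finitely many sets of subformulas that do not derive
  \<open>C\<close>, a maximal one above \<open>X\<close> is a prime theory. \<open>C\<close> itself
  may lie outside \<open>subfms A\<close>; seriality of \<open>E\<close> uses this with
  falsum.\<close>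

lemma prime_theory_extension:
  assumes "X \<subseteq> subfms A" and "\<not> derivable_from L X C"
  obtains Y where "Y \<in> prime_theories L A" and "X \<subseteq> Y" and "\<not> derivable_from L Y C"
proof -
  let ?F = "{Y. Y \<subseteq> subfms A \<and> \<not> derivable_from L Y C}"
  have "finite ?F"
    by (rule finite_subset[of _ "Pow (subfms A)"]) (auto simp: finite_subfms)
  moreover have "X \<in> ?F"
    using assms by simp
  ultimately obtain Y where Y: "Y \<in> ?F" "X \<subseteq> Y" and max: "\<And>Z. Z \<in> ?F \<Longrightarrow> Y \<subseteq> Z \<Longrightarrow> Z = Y"
    using finite_has_maximal2[of ?F X] by (metis (lifting))
  \<comment> \<open>Otherwise \<open>insert B Y\<close> would be a strictly larger member of
    \<open>?F\<close>.\<close>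
  have maxD: "derivable_from L (insert B Y) C" if "B \<in> subfms A" "B \<notin> Y" for B
    using max[of "insert B Y"] that Y by blast
  \<comment> \<open>If \<open>B\<close> were missing, cutting it out of the derivation given by
    \<open>maxD\<close> would derive \<open>C\<close> from \<open>Y\<close>.\<close>
  have "B \<in> Y" if "B \<in> subfms A" "derivable_from L Y B" for B
    using maxD that Y derivable_from_cut by blast
  \<comment> \<open>If both disjuncts were missing, each would yield \<open>C\<close> together with
    \<open>Y\<close>, hence so would the disjunction.\<close>
  moreover have "B \<in> Y \<or> D \<in> Y" if "B \<^bold>\<or> D \<in> Y" for B D
    using maxD that Y derivable_from_Disj_elim[OF Hyp[OF that]] subfms_components(2)[of B D A]
    by blast
  moreover have "\<not> derivable_from L Y \<^bold>\<bottom>"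
    using Y derivable_from_Falsum by blast
  ultimately have "Y \<in> prime_theories L A"
    using Y by (auto simp: prime_theories_def)
  then show ?thesis
    using that Y by blast
qed

section \<open>The finite canonical model\<close>

text \<open>The map \<open>f\<close> transports the theories into the given type of worlds.
  Relations and valuation are phrased through preimages, which are unique once \<open>f\<close> is
  injective on the prime theories.\<close>

definition canonical_model :: "logic \<Rightarrow> fm \<Rightarrow> (fm set \<Rightarrow> 'w) \<Rightarrow> 'w model" where
  "canonical_model L A f =
    (let W = prime_theories L A in
     \<lparr>worlds = f ` W,
      R = {(f X, f Y) | X Y. X \<in> W \<and> Y \<in> W \<and> X \<subseteq> Y},
      val = \<lambda>u p. \<exists>X\<in>W. u = f X \<and> Letter p \<in> X,
      E = {(f X, f Y) | X Y. X \<in> W \<and> Y \<in> W \<and> X \<union> {B. \<^bold>K B \<in> X} \<subseteq> Y}\<rparr>)"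

context
  fixes L :: logic and A :: fm and f :: "fm set \<Rightarrow> 'w"
  assumes inj: "inj_on f (prime_theories L A)"
begin

private abbreviation "W \<equiv> prime_theories L A"
private abbreviation "M \<equiv> canonical_model L A f"

lemma worlds_canonical: "worlds M = f ` W"
  by (simp add: canonical_model_def Let_def)

text \<open>Injectivity recovers the theory \<open>X\<close> from the world \<open>f X\<close>, so
  successors can be computed on theories.\<close>

lemma R_canonical_iff:
  assumes "X \<in> W"
  shows "(f X, v) \<in> R M \<longleftrightarrow> (\<exists>Y\<in>W. v = f Y \<and> X \<subseteq> Y)"
  using assms inj by (auto simp: canonical_model_def Let_def dest: inj_onD)

lemma E_canonical_iff:
  assumes "X \<in> W"
  shows "(f X, v) \<in> E M \<longleftrightarrow> (\<exists>Y\<in>W. v = f Y \<and> X \<union> {B. \<^bold>K B \<in> X} \<subseteq> Y)"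
  using assms inj by (auto simp: canonical_model_def Let_def dest: inj_onD)

lemma val_canonical_iff:
  assumes "X \<in> W"
  shows "val M (f X) p \<longleftrightarrow> Letter p \<in> X"
  using assms inj by (auto simp: canonical_model_def Let_def dest: inj_onD)

lemma R_canonicalE:
  assumes "(u, v) \<in> R M"
  obtains X Y where "X \<in> W" "Y \<in> W" "u = f X" "v = f Y" "X \<subseteq> Y"
  using assms by (auto simp: canonical_model_def Let_def)

text \<open>By \<open>derivable_from_Know\<close>, the formulas that every
  \<open>E\<close>-successor must contain do not derive \<open>C\<close>, so they extend to a prime
  theory that does not derive it either.\<close>

lemma E_successor:
  assumes "X \<in> W" and "\<not> derivable_from L X (\<^bold>K C)"
  obtains Y where "Y \<in> W" "X \<union> {B. \<^bold>K B \<in> X} \<subseteq> Y" "\<not> derivable_from L Y C"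
proof (rule prime_theory_extension)
  show "X \<union> {B. \<^bold>K B \<in> X} \<subseteq> subfms A"
    using assms subfms_components(4)[of _ A] by (auto simp: prime_theories_def)
  show "\<not> derivable_from L (X \<union> {B. \<^bold>K B \<in> X}) C"
    using assms derivable_from_Know by blast
qed

lemma canonical_is_IEL_minus_model:
  assumes "W \<noteq> {}"
  shows "is_IEL_minus_model M"
proof -
  have "refl_on (worlds M) (R M)"
    by (auto simp: refl_on_def worlds_canonical R_canonical_iff elim: R_canonicalE)
  moreover have "R M \<subseteq> worlds M \<times> worlds M"
    by (auto simp: worlds_canonical elim!: R_canonicalE)
  moreover have "trans (R M)"
    by (rule transI, erule R_canonicalE) (auto simp: R_canonical_iff)
  moreover have "antisym (R M)"
    by (rule antisymI, erule R_canonicalE) (auto simp: R_canonical_iff dest!: inj_onD[OF inj])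
  moreover have "val M v p" if "(u, v) \<in> R M" "val M u p" for u v p
    using that by (auto simp: val_canonical_iff elim!: R_canonicalE)
  moreover have "E M \<subseteq> worlds M \<times> worlds M"
    by (auto simp: canonical_model_def Let_def)
  moreover have "E M `` {u} \<subseteq> R M `` {u}" if "u \<in> worlds M" for u
    using that by (auto simp: worlds_canonical E_canonical_iff R_canonical_iff)
  \<comment> \<open>A larger theory contains more formulas K B and so imposes more conditions on its
    \<open>E\<close>-successors.\<close>
  moreover have "E M `` {v} \<subseteq> E M `` {u}" if "(u, v) \<in> R M" for u v
    using that by (elim R_canonicalE) (auto simp: E_canonical_iff, blast)
  ultimately show ?thesis
    using assms
    by (auto simp: is_IEL_minus_model_def partial_order_on_def preorder_on_def worlds_canonical)
qed

lemma canonical_is_model: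
  assumes "W \<noteq> {}"
  shows "is_model L M"
proof (cases L)
  case IEL_minus
  then show ?thesis
    using canonical_is_IEL_minus_model assms by simp
next
  case IEL
  have "\<forall>u\<in>worlds M. E M `` {u} \<noteq> {}"
  proof
    fix u assume "u \<in> worlds M"
    then obtain X where X: "X \<in> W" and u: "u = f X"
      by (auto simp: worlds_canonical)
    \<comment> \<open>With falsum for \<open>C\<close>, \<open>E_successor\<close> then supplies a
      successor.\<close>
    have "\<not> derivable_from L X (\<^bold>K \<^bold>\<bottom>)"
    proof
      assume "derivable_from L X (\<^bold>K \<^bold>\<bottom>)"
      \<comment> \<open>Reflection gives the double negation of falsum; applying it to the theorem
        that falsum implies falsum yields falsum.\<close>
      then have "derivable_from L X \<^bold>\<bottom>"
        by (meson Reflection[OF IEL] derivable_imp_refl derivable_from.MP Thm)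
      then show False
        using X by (simp add: prime_theories_def)
    qed
    then obtain Y where "Y \<in> W" "X \<union> {B. \<^bold>K B \<in> X} \<subseteq> Y"
      using E_successor X by blast
    then show "E M `` {u} \<noteq> {}"
      using E_canonical_iff[OF X] u by blast
  qed
  then show ?thesis
    using IEL canonical_is_IEL_minus_model[OF assms] by (simp add: is_IEL_model_def)
qed

text \<open>For implication and K, membership gives forcing by closure of theories and the
  definition of \<open>E\<close>. Conversely, if the formula were not derivable from
  \<open>X\<close>, \<open>prime_theory_extension\<close> or \<open>E_successor\<close> would give a
  successor theory at which it fails.\<close>

lemma truth_lemma:
  assumes "B \<in> subfms A" and "X \<in> W"
  shows "forces M (f X) B \<longleftrightarrow> B \<in> X"
  using assms
proof (induction B arbitrary: X)
  case (Letter p)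
  then show ?case
    by (simp add: val_canonical_iff)
next
  case Falsum
  then show ?case
    by (auto simp: prime_theories_def intro: Hyp)
next
  case (Conj B C)
  then show ?case
    using subfms_components(1)[of B C A]
    by (simp add: prime_theory_mem_iff derivable_from_Conj_iff)
next
  case (Disj B C)
  then have sub: "B \<in> subfms A" "C \<in> subfms A"
    using subfms_components(2)[of B C A] by auto
  have "B \<^bold>\<or> C \<in> X \<longleftrightarrow> B \<in> X \<or> C \<in> X"
  proof
    assume "B \<^bold>\<or> C \<in> X"
    then show "B \<in> X \<or> C \<in> X"
      using Disj.prems by (auto simp: prime_theories_def)
  next
    assume "B \<in> X \<or> C \<in> X"
    then show "B \<^bold>\<or> C \<in> X"
      using Disj.prems by (meson DisjI1 DisjI2 Hyp Thm derivable_from.MP prime_theory_mem_iff)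
  qed
  then show ?case
    using Disj sub by simp
next
  case (Impl B C)
  then have sub: "B \<in> subfms A" "C \<in> subfms A"
    using subfms_components(3)[of B C A] by auto
  have "B \<^bold>\<rightarrow> C \<in> X \<longleftrightarrow> (\<forall>Y\<in>W. X \<subseteq> Y \<longrightarrow> B \<in> Y \<longrightarrow> C \<in> Y)"
  proof (intro iffI ballI impI)
    fix Y
    assume "B \<^bold>\<rightarrow> C \<in> X" "Y \<in> W" "X \<subseteq> Y" "B \<in> Y"
    then show "C \<in> Y"
      using sub by (meson Hyp derivable_from.MP prime_theory_mem_iff subsetD)
  next
    assume *: "\<forall>Y\<in>W. X \<subseteq> Y \<longrightarrow> B \<in> Y \<longrightarrow> C \<in> Y"
    have "derivable_from L (insert B X) C"
    proof (rule ccontr)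
      assume "\<not> derivable_from L (insert B X) C"
      moreover have "insert B X \<subseteq> subfms A"
        using Impl.prems sub by (auto simp: prime_theories_def)
      ultimately obtain Y where "Y \<in> W" "insert B X \<subseteq> Y" "\<not> derivable_from L Y C"
        using prime_theory_extension by metis
      moreover from this have "C \<in> Y"
        using * by simp
      ultimately show False
        by (simp add: Hyp)
    qed
    then show "B \<^bold>\<rightarrow> C \<in> X"
      using deduction Impl.prems prime_theory_mem_iff by blast
  qed
  moreover have "forces M (f X) (B \<^bold>\<rightarrow> C) \<longleftrightarrow> (\<forall>Y\<in>W. X \<subseteq> Y \<longrightarrow> B \<in> Y \<longrightarrow> C \<in> Y)"
  proof -
    \<comment> \<open>Every successor is the image of a theory, so the induction hypothesis, which
      is general in \<open>X\<close>, applies to it.\<close>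
    have "R M `` {f X} = f ` {Y \<in> W. X \<subseteq> Y}"
      using Impl.prems by (auto simp: R_canonical_iff)
    then show ?thesis
      using Impl.IH sub by (simp, blast)
  qed
  ultimately show ?case
    by blast
next
  case (Know B)
  then have sub: "B \<in> subfms A"
    using subfms_components(4) by blast
  have "\<^bold>K B \<in> X \<longleftrightarrow> (\<forall>Y\<in>W. X \<union> {B. \<^bold>K B \<in> X} \<subseteq> Y \<longrightarrow> B \<in> Y)"
  proof
    assume *: "\<forall>Y\<in>W. X \<union> {B. \<^bold>K B \<in> X} \<subseteq> Y \<longrightarrow> B \<in> Y"
    have "derivable_from L X (\<^bold>K B)"
    proof (rule ccontr)
      assume "\<not> derivable_from L X (\<^bold>K B)"
      then obtain Y where "Y \<in> W" "X \<union> {B. \<^bold>K B \<in> X} \<subseteq> Y" "\<not> derivable_from L Y B"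
        using E_successor Know.prems(2) by blast
      then show False
        using * by (simp add: Hyp)
    qed
    then show "\<^bold>K B \<in> X"
      using Know.prems prime_theory_mem_iff by blast
  qed blast
  moreover have "forces M (f X) (\<^bold>K B) \<longleftrightarrow> (\<forall>Y\<in>W. X \<union> {B. \<^bold>K B \<in> X} \<subseteq> Y \<longrightarrow> B \<in> Y)"
  proof -
    have "E M `` {f X} = f ` {Y \<in> W. X \<union> {B. \<^bold>K B \<in> X} \<subseteq> Y}"
      using Know.prems by (auto simp: E_canonical_iff)
    then show ?thesis
      using Know.IH sub by (simp, blast)
  qed
  ultimately show ?case
    by blast
qed

end

section \<open>Countermodels over an arbitrary infinite type\<close>

lemma finite_inj_into_infinite:
  assumes "finite S" and "infinite (UNIV :: 'b set)"
  obtains f :: "'a \<Rightarrow> 'b" where "inj_on f S"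
proof -
  obtain T :: "'b set" where "finite T" "card T = card S"
    using infinite_arbitrarily_large[OF assms(2)] by blast
  then show ?thesis
    using that finite_same_card_bij[OF assms(1)] bij_betw_def by metis
qed

theorem theorem4:
  fixes L :: logic and A :: fm
  assumes "infinite (UNIV :: 'w set)"
    and "valid TYPE('w) L A"
  shows "L \<turnstile> A"
proof (rule ccontr)
  assume "\<not> L \<turnstile> A"
  then have "\<not> derivable_from L {} A"
    using derivable_from_empty by blast
  then obtain X where X: "X \<in> prime_theories L A" "\<not> derivable_from L X A"
    using prime_theory_extension[of "{}"] by blast
  obtain f :: "fm set \<Rightarrow> 'w" where inj: "inj_on f (prime_theories L A)"
    using finite_inj_into_infinite[OF finite_prime_theories assms(1)] .
  \<comment> \<open>The theory \<open>X\<close> makes the set of worlds non-empty.\<close>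
  have "is_model L (canonical_model L A f)"
    using canonical_is_model[OF inj] X by blast
  then have "forces (canonical_model L A f) (f X) A"
    using assms(2) X worlds_canonical[OF inj] by (auto simp: valid_def true_in_def)
  then show False
    using truth_lemma[OF inj subfms_refl X(1)] X(2) by (simp add: Hyp)
qed

end
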